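(* Let $k\geq 2$ be an integer and let $P(z)\in\mathbb C[z]$ be a polynomial with constant coefficient $1$. Then the power series $$A(z)=\prod_{n=0}^\infty P\left(z^{k^n}\right)$$ is $k$-regular. Moreover, if all roots of $P(z)$ are roots of unity (of finite order), then the logarithmic derivative $B=A'/A$ is also $k$-regular.
   Context: For $0\leq i\leq k-1$, let $\rho(i)$ be the linear map on $\mathbb C[[z]]$ given by $\rho(i)\left(\sum_n a(n)z^n\right)=\sum_n a(i+nk)z^n$. The $k$-kernel of $A\in\mathbb C[[z]]$ is the smallest vector subspace containing $A$ and stable under $\rho(0),\dots,\rho(k-1)$; $A$ is $k$-regular if its $k$-kernel is finite-dimensional. *)

theory Defs
  imports
    "HOL-Analysis.Infinite_Products"
    "HOL-Computational_Algebra.Computational_Algebra"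
begin

global_interpretation cfps: vector_space "\<lambda>(c::complex) (F::complex fps). fps_const c * F"
  by unfold_locales (simp_all add: algebra_simps flip: fps_const_add fps_const_mult)

definition rho :: "nat \<Rightarrow> nat \<Rightarrow> complex fps \<Rightarrow> complex fps" where
  "rho k i F = Abs_fps (\<lambda>n. fps_nth F (i + n * k))"

definition k_kernel :: "nat \<Rightarrow> complex fps \<Rightarrow> complex fps set" where
  "k_kernel k A = \<Inter>{V. cfps.subspace V \<and> A \<in> V \<and> (\<forall>i<k. \<forall>F\<in>V. rho k i F \<in> V)}"

definition k_regular :: "nat \<Rightarrow> complex fps \<Rightarrow> bool" where
  "k_regular k A \<longleftrightarrow> (\<exists>S. finite S \<and> cfps.span S = k_kernel k A)"

definition mahler_factor :: "nat \<Rightarrow> complex poly \<Rightarrow> nat \<Rightarrow> complex fps" where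
  "mahler_factor k P n = fps_of_poly (P \<circ>\<^sub>p monom 1 (k ^ n))"

text \<open>The infinite product is taken in the metric (\<open>z\<close>-adic) topology of the library on formal
  power series.\<close>

definition mahler_product :: "nat \<Rightarrow> complex poly \<Rightarrow> complex fps" where
  "mahler_product k P = (\<Prod>n. mahler_factor k P n)"

end

(* The product satisfies A(z) = P(z) A(z^k), and rho(i) (F(z) G(z^k)) = rho(i)(F) G. Hence the
   multiples Q A with deg Q <= deg P form a finite-dimensional space that contains A and is stable
   under every rho(i). Taking logarithmic derivatives, B = P'/P + k z^(k-1) B(z^k). If the roots of P
   are roots of unity, then the coefficients of P'/P are periodic from the start, with some period m.
   The m-periodic series form a finite-dimensional space stable under every rho(i), and adding the
   line spanned by B keeps it stable. *)

theory Submission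
  imports Defs
begin

section \<open>Finite-dimensional stable spaces\<close>

text \<open>The kernel is the smallest stable subspace, so it lies in any stable span containing
  \<open>A\<close>; since \<open>rho\<close> is linear, checking stability on generators is
  enough.\<close>

lemma k_regularI:
  assumes fin: "finite S" and A: "A \<in> cfps.span S"
    and rho: "\<And>i F. i < k \<Longrightarrow> F \<in> S \<Longrightarrow> rho k i F \<in> cfps.span S"
  shows "k_regular k A"
proof -
  have "rho k i F \<in> cfps.span S" if "i < k" "F \<in> cfps.span S" for i F
    using that(2)
  proof (rule cfps.span_induct)
    show "cfps.subspace {F. rho k i F \<in> cfps.span S}"
    proof (rule cfps.subspaceI)
      have "rho k i 0 = 0"
        by (simp add: rho_def fps_eq_iff)
      then show "0 \<in> {F. rho k i F \<in> cfps.span S}"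
        by (simp add: cfps.span_zero)
    next
      fix F G assume *: "F \<in> {F. rho k i F \<in> cfps.span S}" "G \<in> {F. rho k i F \<in> cfps.span S}"
      have "rho k i (F + G) = rho k i F + rho k i G"
        by (simp add: rho_def fps_eq_iff)
      then show "F + G \<in> {F. rho k i F \<in> cfps.span S}"
        using * by (simp add: cfps.span_add)
    next
      fix c F assume *: "F \<in> {F. rho k i F \<in> cfps.span S}"
      have "rho k i (fps_const c * F) = fps_const c * rho k i F"
        by (simp add: rho_def fps_eq_iff)
      then show "fps_const c * F \<in> {F. rho k i F \<in> cfps.span S}"
        using * cfps.span_scale by simp
    qed
  qed (use rho that(1) in auto)
  then have sub: "k_kernel k A \<subseteq> cfps.span S"
    unfolding k_kernel_def using A by (intro Inter_lower) auto
  have subspace: "cfps.subspace (k_kernel k A)"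
    unfolding k_kernel_def by (rule cfps.subspace_Inter) auto
  \<comment> \<open>The kernel may be a proper subspace of the span of \<open>S\<close>, so a basis
    of the kernel itself is chosen; it is finite because it is independent inside a finitely
    generated space.\<close>
  obtain B where B: "B \<subseteq> k_kernel k A" "cfps.independent B" "k_kernel k A \<subseteq> cfps.span B"
    using cfps.maximal_independent_subset by blast
  have "finite B"
    using cfps.independent_span_bound[OF fin B(2)] B(1) sub by blast
  moreover have "cfps.span B = k_kernel k A"
    using cfps.span_subspace[OF B(1,3) subspace] .
  ultimately show ?thesis
    unfolding k_regular_def by blast
qed

section \<open>Sections of products with a series in z^k\<close>

text \<open>Only multiples of \<open>k\<close> occur as exponents in \<open>G oo fps_X ^ k\<close>,
  so coefficient \<open>i + n * k\<close> of the product pairs exponent \<open>c * k\<close> with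
  \<open>i + (n - c) * k\<close>.\<close>

lemma rho_mult_compose_X_power:
  assumes "i < k"
  shows "rho k i (F * (G oo fps_X ^ k)) = rho k i F * G"
proof (rule fps_ext)
  fix n
  have k: "k > 0"
    using assms by simp
  have "fps_nth (rho k i (F * (G oo fps_X ^ k))) n =
      (\<Sum>b\<le>i + n * k. if k dvd b then fps_nth F (i + n * k - b) * fps_nth G (b div k) else 0)"
    unfolding mult.commute[of F] rho_def fps_nth_Abs_fps fps_mult_nth atLeast0AtMost
    by (intro sum.cong) (auto simp: fps_nth_compose_X_power)
  also have "\<dots> = (\<Sum>b | b \<le> i + n * k \<and> k dvd b. fps_nth F (i + n * k - b) * fps_nth G (b div k))"
    by (subst sum.inter_filter [symmetric]) auto
  also have "\<dots> = (\<Sum>c\<le>n. fps_nth F (i + n * k - c * k) * fps_nth G c)"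
  proof (rule sum.reindex_bij_witness[where i = "\<lambda>c. c * k" and j = "\<lambda>b. b div k"])
    fix b assume b: "b \<in> {b. b \<le> i + n * k \<and> k dvd b}"
    then have "b div k \<le> (i + n * k) div k"
      by (intro div_le_mono) auto
    \<comment> \<open>Here \<open>i < k\<close> enters: it gives
      \<open>(i + n * k) div k = n\<close>.\<close>
    then show "b div k \<in> {..n}"
      using assms by simp
  qed (use k in \<open>auto simp: trans_le_add2\<close>)
  also have "\<dots> = (\<Sum>c\<le>n. fps_nth F (i + (n - c) * k) * fps_nth G c)"
    by (intro sum.cong) (auto simp: diff_mult_distrib)
  also have "\<dots> = fps_nth (rho k i F * G) n"
    by (subst mult.commute) (simp add: rho_def fps_mult_nth atLeast0AtMost mult.commute)
  finally show "fps_nth (rho k i (F * (G oo fps_X ^ k))) n = fps_nth (rho k i F * G) n" .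
qed

section \<open>Periodic power series\<close>

text \<open>There is no preperiod, and \<open>m\<close> is any period rather than the least one,
  which allows passing to common multiples. Every series has period 0, so \<open>m > 0\<close> is
  required separately.\<close>

definition periodic_fps :: "nat \<Rightarrow> 'a::zero fps \<Rightarrow> bool" where
  "periodic_fps m F \<longleftrightarrow> (\<forall>n. fps_nth F (n + m) = fps_nth F n)"

lemma periodic_fps_nth_add_mult:
  assumes "periodic_fps m F"
  shows "fps_nth F (n + l * m) = fps_nth F n"
proof (induction l)
  case (Suc l)
  have "fps_nth F (n + Suc l * m) = fps_nth F ((n + l * m) + m)"
    by (simp add: ac_simps)
  then show ?case
    using Suc assms by (simp only: periodic_fps_def)
qed simp

lemma periodic_fps_mult:
  assumes "periodic_fps m F"
  shows "periodic_fps (l * m) F"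
  using periodic_fps_nth_add_mult[OF assms] by (simp add: periodic_fps_def)

lemma periodic_fps_add:
  fixes F G :: "'a::comm_monoid_add fps"
  assumes "periodic_fps m F" "periodic_fps m G"
  shows "periodic_fps m (F + G)"
  using assms by (simp add: periodic_fps_def)

text \<open>A shift by \<open>m\<close> in the section is a shift by \<open>k * m\<close> in
  \<open>F\<close>, a multiple of the period.\<close>

lemma periodic_fps_rho:
  assumes "periodic_fps m F"
  shows "periodic_fps m (rho k i F)"
  unfolding periodic_fps_def
proof
  fix n
  have "fps_nth (rho k i F) (n + m) = fps_nth F (i + n * k + k * m)"
    by (simp add: rho_def algebra_simps)
  also have "\<dots> = fps_nth (rho k i F) n"
    using periodic_fps_nth_add_mult[OF assms] by (simp add: rho_def)
  finally show "fps_nth (rho k i F) (n + m) = fps_nth (rho k i F) n" .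
qed

text \<open>The generators are the indicator series of the residue classes modulo \<open>m\<close>;
  the scalars are the first \<open>m\<close> coefficients of \<open>F\<close>.\<close>

lemma periodic_fps_in_span:
  assumes "periodic_fps m F" "m > 0"
  shows "F \<in> cfps.span ((\<lambda>j. Abs_fps (\<lambda>n. if n mod m = j then 1 else 0)) ` {..<m})"
    (is "_ \<in> cfps.span (?e ` _)")
proof -
  have "F = (\<Sum>j<m. fps_const (fps_nth F j) * ?e j)"
  proof (rule fps_ext)
    fix n
    have "fps_nth (\<Sum>j<m. fps_const (fps_nth F j) * ?e j) n = (\<Sum>j<m. if j = n mod m then fps_nth F j else 0)"
      unfolding fps_sum_nth by (intro sum.cong) auto
    also have "\<dots> = fps_nth F (n mod m)"
      using assms(2) by (simp add: sum.delta)
    also have "\<dots> = fps_nth F n"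
      using periodic_fps_nth_add_mult[OF assms(1), of "n mod m" "n div m"] by simp
    finally show "fps_nth F n = fps_nth (\<Sum>j<m. fps_const (fps_nth F j) * ?e j) n" by simp
  qed
  also have "\<dots> \<in> cfps.span (?e ` {..<m})"
    by (intro cfps.span_sum cfps.span_scale cfps.span_base) auto
  finally show ?thesis .
qed

lemma periodic_fps_basis:
  "periodic_fps m (Abs_fps (\<lambda>n. if n mod m = j then 1 else (0::'a::zero_neq_one)))"
  by (simp add: periodic_fps_def)

section \<open>Logarithmic derivatives of polynomials\<close>

text \<open>By the geometric series, 1/(z - r) has coefficients -r^(-n-1), and the powers of a root
  of unity repeat.\<close>

lemma periodic_inverse_linear:
  fixes r :: complex
  assumes "r ^ m = 1" "m > 0"
  shows "periodic_fps m (inverse (fps_X - fps_const r))"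
proof -
  have r: "r \<noteq> 0"
    using assms by (auto simp: power_0_left)
  have "(fps_X - fps_const r) * Abs_fps (\<lambda>n. - (inverse r ^ Suc n)) = 1"
  proof (rule fps_ext)
    fix n
    show "fps_nth ((fps_X - fps_const r) * Abs_fps (\<lambda>n. - (inverse r ^ Suc n))) n = fps_nth 1 n"
      using r by (cases n) (simp_all add: left_diff_distrib)
  qed
  then have "inverse (fps_X - fps_const r) = Abs_fps (\<lambda>n. - (inverse r ^ Suc n))"
    by (rule fps_inverse_unique)
  moreover have "inverse r ^ m = 1"
    using assms by (simp add: power_inverse)
  ultimately show ?thesis
    by (simp add: periodic_fps_def power_add)
qed

text \<open>Logarithmic derivatives turn products into sums. Splitting off one root \<open>r\<close>
  at a time contributes 1/(z - r), which is periodic.\<close>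

lemma periodic_log_deriv_poly:
  fixes P :: "complex poly"
  assumes "P \<noteq> 0" "\<And>z. poly P z = 0 \<Longrightarrow> \<exists>m>0. z ^ m = 1"
  shows "\<exists>m>0. periodic_fps m (fps_deriv (fps_of_poly P) * inverse (fps_of_poly P))"
  using assms
proof (induction "degree P" arbitrary: P rule: less_induct)
  case less
  show ?case
  proof (cases "degree P = 0")
    case True
    then obtain c where "P = [:c:]"
      by (rule degree_eq_zeroE)
    then show ?thesis
      by (auto simp: fps_of_poly_const periodic_fps_def)
  next
    case False
    then obtain r where r: "poly P r = 0"
      using fundamental_theorem_of_algebra constant_degree by metis
    then obtain Q where Q: "P = [:- r, 1:] * Q"
      by (auto simp: poly_eq_0_iff_dvd)
    obtain m where m: "m > 0" "r ^ m = 1"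
      using less.prems(2)[OF r] by blast
    have Q0: "Q \<noteq> 0"
      using less.prems(1) Q by auto
    have "degree P = Suc (degree Q)"
      using Q0 unfolding Q by (subst degree_mult_eq) auto
    moreover have "\<exists>m>0. z ^ m = 1" if "poly Q z = 0" for z
      using less.prems(2)[of z] that Q by simp
    ultimately obtain l where l: "l > 0"
      "periodic_fps l (fps_deriv (fps_of_poly Q) * inverse (fps_of_poly Q))"
      using less.hyps[of Q] Q0 by auto
    define L where "L = fps_X - fps_const r"
    define q where "q = fps_of_poly Q"
    have r0: "r \<noteq> 0"
      using m by (auto simp: power_0_left)
    \<comment> \<open>Zero is not a root of unity, so \<open>P\<close> has nonzero constant
      coefficient; hence its factor \<open>q\<close> is invertible as a power series.\<close>
    have q0: "fps_nth q 0 \<noteq> 0"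
    proof
      assume "fps_nth q 0 = 0"
      then have "poly P 0 = 0"
        by (simp add: q_def Q poly_0_coeff_0)
      then show False
        using less.prems(2)[of 0] by (auto simp: power_0_left)
    qed
    have L1: "L * inverse L = 1" "fps_deriv L = 1" and q1: "q * inverse q = 1"
      using r0 q0 by (auto simp: L_def inverse_mult_eq_1')
    have P: "fps_of_poly P = L * q"
      unfolding Q L_def q_def fps_of_poly_mult
      by (simp add: fps_of_poly_pCons fps_of_poly_const flip: fps_const_neg)
    have "fps_deriv (L * q) * inverse (L * q) =
        inverse L * (q * inverse q) + (fps_deriv q * inverse q) * (L * inverse L)"
      by (simp add: fps_inverse_mult L1(2) algebra_simps)
    also have "\<dots> = inverse L + fps_deriv q * inverse q"
      by (simp only: L1 q1 mult_1_right)
    finally have "fps_deriv (fps_of_poly P) * inverse (fps_of_poly P) = inverse L + fps_deriv q * inverse q"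
      unfolding P .
    \<comment> \<open>The two summands have periods \<open>m\<close> and \<open>l\<close>;
      \<open>l * m\<close> serves as a common period.\<close>
    moreover have "periodic_fps (l * m) (inverse L)"
      using periodic_inverse_linear[OF m(2,1)] periodic_fps_mult unfolding L_def by blast
    moreover have "periodic_fps (l * m) (fps_deriv q * inverse q)"
      using periodic_fps_mult[OF l(2), of m] by (simp add: q_def mult.commute)
    ultimately have "periodic_fps (l * m) (fps_deriv (fps_of_poly P) * inverse (fps_of_poly P))"
      by (simp add: periodic_fps_add)
    then show ?thesis
      using l(1) m(1) by (intro exI[of _ "l * m"]) simp
  qed
qed

section \<open>The infinite product and its functional equation\<close>

context
  fixes k :: nat and P :: "complex poly"
  assumes k: "k \<ge> 2" and P0: "coeff P 0 = 1"
begin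

lemma mahler_factor_eq: "mahler_factor k P n = fps_of_poly P oo fps_X ^ (k ^ n)"
  using k unfolding mahler_factor_def by (subst fps_of_poly_pcompose) (auto simp: fps_of_poly_monom')

text \<open>The only multiple of \<open>k ^ N\<close> below \<open>k ^ N\<close> is 0: the factor is
  1 + O(z^(k^N)), which drives the convergence.\<close>

lemma mahler_factor_nth_less:
  assumes "n < k ^ N"
  shows "fps_nth (mahler_factor k P N) n = (if n = 0 then 1 else 0)"
  using assms P0 k by (auto simp: mahler_factor_eq fps_nth_compose_X_power dest: dvd_imp_le)

text \<open>Substituting z^k turns factor \<open>i\<close> into factor \<open>i + 1\<close>; the
  factor left over is the one of index 0, namely \<open>P\<close>.\<close>

lemma mahler_partial_product_Suc:
  "(\<Prod>i\<le>Suc N. mahler_factor k P i) = fps_of_poly P * ((\<Prod>i\<le>N. mahler_factor k P i) oo fps_X ^ k)"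
proof -
  have "mahler_factor k P (Suc i) = mahler_factor k P i oo fps_X ^ k" for i
    using k by (simp add: mahler_factor_eq fps_X_power_compose power_mult mult.commute flip: fps_compose_assoc)
  then show ?thesis
    using k by (subst prod.atMost_Suc_shift) (simp add: fps_compose_prod_distrib mahler_factor_eq)
qed

text \<open>Each later factor is 1 up to order \<open>n\<close>, because
  \<open>n < 2 ^ Suc N \<le> k ^ Suc N\<close> for \<open>n \<le> N\<close>.\<close>

lemma mahler_partial_product_nth:
  assumes "n \<le> N"
  shows "fps_nth (\<Prod>i\<le>N. mahler_factor k P i) n = fps_nth (\<Prod>i\<le>n. mahler_factor k P i) n"
  using assms
proof (induction N rule: dec_induct)
  case (step N)
  have "n < k ^ Suc N"
  proof -
    have "n < 2 ^ Suc N"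
      using step(1) less_exp[of "Suc N"] by linarith
    also have "\<dots> \<le> k ^ Suc N"
      using k by (rule power_mono) simp
    finally show ?thesis .
  qed
  then have "fps_nth (mahler_factor k P (Suc N)) j = (if j = 0 then 1 else 0)" if "j \<le> n" for j
    using that by (intro mahler_factor_nth_less) simp
  then have "fps_nth ((\<Prod>i\<le>N. mahler_factor k P i) * mahler_factor k P (Suc N)) n =
      (\<Sum>j=0..n. if j = n then fps_nth (\<Prod>i\<le>N. mahler_factor k P i) j else 0)"
    unfolding fps_mult_nth by (intro sum.cong) auto
  then show ?case
    using step(3) by simp
qed simp

lemma has_prod_mahler_product: "mahler_factor k P has_prod mahler_product k P"
  and mahler_product_nth:
    "n \<le> N \<Longrightarrow> fps_nth (mahler_product k P) n = fps_nth (\<Prod>i\<le>N. mahler_factor k P i) n"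
proof -
  \<comment> \<open>The limit is read off diagonally: coefficient \<open>n\<close> is already final
    in the partial product up to index \<open>n\<close>.\<close>
  define A where "A = Abs_fps (\<lambda>n. fps_nth (\<Prod>i\<le>n. mahler_factor k P i) n)"
  have A: "fps_nth A n = fps_nth (\<Prod>i\<le>N. mahler_factor k P i) n" if "n \<le> N" for n N
    using mahler_partial_product_nth[OF that] by (simp add: A_def)
  have lim: "(\<lambda>N. \<Prod>i\<le>N. mahler_factor k P i) \<longlonglongrightarrow> A"
    by (intro tendsto_fpsI eventually_sequentiallyI) (rule A[symmetric])
  \<comment> \<open>\<open>raw_has_prod\<close> demands a nonzero limit.\<close>
  have "fps_nth A 0 = 1"
    using k by (simp add: A_def mahler_factor_nth_less)
  then have "A \<noteq> 0"
    by auto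
  with lim have prod: "mahler_factor k P has_prod A"
    by (simp add: has_prod_def raw_has_prod_def)
  \<comment> \<open>Nonzero factors exclude the case of \<open>has_prod\<close> in which the value
    is 0, so uniqueness of limits identifies the product.\<close>
  have "mahler_factor k P i \<noteq> 0" for i
  proof -
    have "fps_nth (mahler_factor k P i) 0 = 1"
      using k by (simp add: mahler_factor_nth_less)
    then show ?thesis by auto
  qed
  then have "B = A" if "mahler_factor k P has_prod B" for B
    using that lim LIMSEQ_unique by (auto simp: has_prod_def raw_has_prod_def)
  with prod have "mahler_product k P = A"
    unfolding mahler_product_def prodinf_def by (intro the_equality)
  then show "mahler_factor k P has_prod mahler_product k P"
    and "n \<le> N \<Longrightarrow> fps_nth (mahler_product k P) n = fps_nth (\<Prod>i\<le>N. mahler_factor k P i) n"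
    using prod A by auto
qed

lemma mahler_product_nth_0: "fps_nth (mahler_product k P) 0 = 1"
  using mahler_product_nth[of 0 0] k by (simp add: mahler_factor_nth_less)

text \<open>This is the limit of the identity for partial products. Coefficient
  \<open>j \<le> n\<close> of a series in z^k only involves index \<open>j div k \<le> n\<close>, so
  the partial product up to \<open>n\<close> suffices on the right.\<close>

lemma mahler_functional_equation:
  "mahler_product k P = fps_of_poly P * (mahler_product k P oo fps_X ^ k)"
proof (rule fps_ext)
  fix n
  have "fps_nth (mahler_product k P) n =
      fps_nth (fps_of_poly P * ((\<Prod>i\<le>n. mahler_factor k P i) oo fps_X ^ k)) n"
    using mahler_product_nth[of n "Suc n"] mahler_partial_product_Suc by simp
  also have "\<dots> = fps_nth (fps_of_poly P * (mahler_product k P oo fps_X ^ k)) n"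
    unfolding fps_mult_nth using k
    by (intro sum.cong refl arg_cong2[of _ _ _ _ "(*)"])
       (auto simp: fps_nth_compose_X_power intro!: mahler_product_nth[symmetric] le_trans[OF div_le_dividend])
  finally show "fps_nth (mahler_product k P) n =
      fps_nth (fps_of_poly P * (mahler_product k P oo fps_X ^ k)) n" .
qed

section \<open>Regularity of the product\<close>

lemma k_regular_mahler_product: "k_regular k (mahler_product k P)"
proof (rule k_regularI)
  let ?A = "mahler_product k P" and ?d = "degree P"
  let ?S = "(\<lambda>j. fps_X ^ j * ?A) ` {..?d}"
  show "finite ?S"
    by simp
  have "fps_X ^ 0 * ?A \<in> cfps.span ?S"
    by (intro cfps.span_base imageI) simp
  then show "?A \<in> cfps.span ?S"
    by simp
  fix i F assume i: "i < k" and "F \<in> ?S"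
  then obtain j where j: "j \<le> ?d" and F: "F = fps_X ^ j * ?A"
    by auto
  define R where "R = rho k i (fps_X ^ j * fps_of_poly P)"
  \<comment> \<open>Sections divide degrees by \<open>k \<ge> 2\<close>: the product has degree at
    most \<open>2 * ?d\<close>, while \<open>n > ?d\<close> gives
    \<open>n * k \<ge> 2 * ?d + 2\<close>.\<close>
  have "fps_nth R n = 0" if "n > ?d" for n
  proof -
    have "Suc ?d * 2 \<le> n * k"
      using that k by (intro mult_mono) auto
    then have "?d + j < i + n * k"
      using j by simp
    then show ?thesis
      by (auto simp: R_def rho_def fps_X_power_mult_nth coeff_eq_0 less_diff_conv)
  qed
  then have R: "R = (\<Sum>n\<le>?d. fps_const (fps_nth R n) * fps_X ^ n)"
    by (auto simp: fps_eq_iff fps_sum_nth fps_X_power_nth if_distrib not_le cong: if_cong)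
  have "rho k i F = rho k i ((fps_X ^ j * fps_of_poly P) * (?A oo fps_X ^ k))"
    unfolding F using mahler_functional_equation by (simp add: mult.assoc)
  also have "\<dots> = R * ?A"
    unfolding R_def by (rule rho_mult_compose_X_power[OF i])
  also have "\<dots> = (\<Sum>n\<le>?d. fps_const (fps_nth R n) * (fps_X ^ n * ?A))"
    by (subst R) (simp add: sum_distrib_right mult.assoc)
  also have "\<dots> \<in> cfps.span ?S"
    by (intro cfps.span_sum cfps.span_scale cfps.span_base) auto
  finally show "rho k i F \<in> cfps.span ?S" .
qed

section \<open>Regularity of the logarithmic derivative\<close>

text \<open>The chain rule for z^k produces the factor k z^(k-1). The identity is first proved
  multiplied by the product, which is then cancelled.\<close>

lemma mahler_log_deriv_functional_equation:
  defines "B \<equiv> fps_deriv (mahler_product k P) / mahler_product k P"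
  shows "B = fps_deriv (fps_of_poly P) * inverse (fps_of_poly P) +
    of_nat k * fps_X ^ (k - 1) * (B oo fps_X ^ k)"
proof -
  let ?A = "mahler_product k P" and ?p = "fps_of_poly P"
  define Ak where "Ak = ?A oo fps_X ^ k"
  have A: "?A = ?p * Ak"
    unfolding Ak_def by (rule mahler_functional_equation)
  have A0: "?A \<noteq> 0"
    using mahler_product_nth_0 by auto
  have "?A * inverse ?A = 1" and p: "?p * inverse ?p = 1"
    using mahler_product_nth_0 P0 by (auto simp: inverse_mult_eq_1')
  then have B: "fps_deriv ?A = ?A * B"
    using mahler_product_nth_0 by (simp add: B_def fps_divide_unit mult.left_commute)
  have "fps_deriv Ak = (fps_deriv ?A oo fps_X ^ k) * fps_deriv (fps_X ^ k)"
    unfolding Ak_def using k by (intro fps_compose_deriv) simp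
  also have "\<dots> = Ak * (B oo fps_X ^ k) * (of_nat k * fps_X ^ (k - 1))"
    using k unfolding B Ak_def by (simp add: fps_compose_mult_distrib fps_deriv_power')
  finally have "fps_deriv ?A = fps_deriv ?p * Ak + ?p * (Ak * (B oo fps_X ^ k) * (of_nat k * fps_X ^ (k - 1)))"
    by (subst A) simp
  \<comment> \<open>A factor 1 is inserted so that \<open>?p * Ak\<close>, which equals
    \<open>?A\<close>, can be taken out of both terms.\<close>
  also have "\<dots> = (?p * inverse ?p) * fps_deriv ?p * Ak + ?p * Ak * (of_nat k * fps_X ^ (k - 1) * (B oo fps_X ^ k))"
    unfolding p by (simp add: mult_ac)
  also have "\<dots> = ?A * (fps_deriv ?p * inverse ?p + of_nat k * fps_X ^ (k - 1) * (B oo fps_X ^ k))"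
    unfolding A by (simp add: algebra_simps)
  finally show ?thesis
    using A0 unfolding B by simp
qed

lemma k_regular_mahler_log_deriv:
  assumes "\<And>z. poly P z = 0 \<Longrightarrow> \<exists>m>0. z ^ m = 1"
  shows "k_regular k (fps_deriv (mahler_product k P) / mahler_product k P)"
proof -
  define B where "B = fps_deriv (mahler_product k P) / mahler_product k P"
  define D where "D = fps_deriv (fps_of_poly P) * inverse (fps_of_poly P)"
  have "P \<noteq> 0"
    using P0 by auto
  from periodic_log_deriv_poly[OF this assms] obtain m where m: "m > 0" "periodic_fps m D"
    unfolding D_def by blast
  define E :: "complex fps set"
    where "E = (\<lambda>j. Abs_fps (\<lambda>n. if n mod m = j then 1 else 0)) ` {..<m}"
  have span: "F \<in> cfps.span (insert B E)" if "periodic_fps m F" for F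
    using periodic_fps_in_span[OF that m(1)] cfps.span_mono[of E "insert B E"] unfolding E_def by blast
  have "k_regular k B"
  proof (rule k_regularI)
    show "finite (insert B E)"
      by (simp add: E_def)
    show "B \<in> cfps.span (insert B E)"
      by (rule cfps.span_base) simp
    fix i F assume i: "i < k" and "F \<in> insert B E"
    then consider "F = B" | "F \<in> E" by blast
    then show "rho k i F \<in> cfps.span (insert B E)"
    proof cases
      case 1
      \<comment> \<open>Since \<open>i < k\<close>, the equation \<open>i + n * k = k - 1\<close>
        forces \<open>n = 0\<close>. The section of k z^(k-1) is thus a constant, and that of the
        second summand a scalar multiple of \<open>B\<close>.\<close>
      define c :: complex where "c = (if i = k - 1 then of_nat k else 0)"
      have "fps_nth (rho k i (of_nat k * fps_X ^ (k - 1))) n = fps_nth (fps_const c) n" for n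
      proof -
        have "i + n * k = k - 1 \<longleftrightarrow> n = 0 \<and> i = k - 1"
          using i by (cases n) auto
        then show ?thesis
          by (simp add: rho_def c_def fps_X_power_nth flip: fps_of_nat)
      qed
      then have c: "rho k i (of_nat k * fps_X ^ (k - 1)) = fps_const c"
        by (rule fps_ext)
      have "rho k i B = rho k i (D + of_nat k * fps_X ^ (k - 1) * (B oo fps_X ^ k))"
        using mahler_log_deriv_functional_equation unfolding B_def D_def by simp
      also have "\<dots> = rho k i D + rho k i (of_nat k * fps_X ^ (k - 1) * (B oo fps_X ^ k))"
        by (simp add: rho_def fps_eq_iff)
      also have "\<dots> = rho k i D + fps_const c * B"
        unfolding rho_mult_compose_X_power[OF i] c ..
      also have "\<dots> \<in> cfps.span (insert B E)"
        by (intro cfps.span_add cfps.span_scale span periodic_fps_rho m(2) cfps.span_base) simp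
      finally show ?thesis
        unfolding 1 .
    next
      case 2
      \<comment> \<open>A section of an indicator series need not be one of the indicators, but it
        is \<open>m\<close>-periodic and so lies in their span.\<close>
      then have "periodic_fps m F"
        unfolding E_def using periodic_fps_basis by auto
      then show ?thesis
        by (intro span periodic_fps_rho)
    qed
  qed
  then show ?thesis
    by (simp add: B_def)
qed

end

text \<open>The \<open>has_prod\<close> conjunct certifies convergence:
  \<open>mahler_product\<close> is a definite description, which by itself does not assert that the
  product exists.\<close>

theorem mainTheorem6:
  fixes k :: nat and P :: "complex poly" and A :: "complex fps"
  assumes "k \<ge> 2" and "coeff P 0 = 1"
  defines "A \<equiv> mahler_product k P"
  shows "mahler_factor k P has_prod A \<and>
    k_regular k A \<and>
    ((\<forall>z. poly P z = 0 \<longrightarrow> (\<exists>m>0. z ^ m = 1)) \<longrightarrow> k_regular k (fps_deriv A / A))"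
  unfolding A_def using has_prod_mahler_product[OF assms(1,2)] k_regular_mahler_product[OF assms(1,2)]
    k_regular_mahler_log_deriv[OF assms(1,2)] by blast

end
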